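(* Let $n$ be a positive integer, let $P_n$ be the boolean algebra of rank $n$, and let $\mathfrak{Z}_n = Z_{P_n} + Z_{P_n}^t$, where $Z_{P_n}$ is the zeta matrix of $P_n$. If $n \ge 3$ is odd, then $\det(\mathfrak{Z}_n) = 0$. If $n$ is even, then $\det(\mathfrak{Z}_n) = 2^{\alpha_n}$, where the integers $\alpha_n$ (for even $n\ge 2$) are defined recursively by $\alpha_2 = 2$ and $\alpha_n = 4\alpha_{n-2} - 2$ for even $n \ge 4$.
   Context: The boolean algebra $P_n$ of rank $n$ is the poset of all subsets of $[n]=\{1,2,\ldots,n\}$ ordered by inclusion; it has $2^n$ elements. For a finite poset $P$ with $N$ elements labelled $x_1,\ldots,x_N$ so that $x_i < x_j$ implies $i<j$, the zeta matrix $Z_P$ is the $N\times N$ matrix with $(Z_P)_{ij}=1$ if $x_i\le x_j$ and $(Z_P)_{ij}=0$ otherwise. The superscript $t$ denotes transpose. *)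

theory Defs
  imports Complex_Main "Jordan_Normal_Form.Determinant"
begin

definition boolean_poset :: "nat \<Rightarrow> nat set set" where
  "boolean_poset n = Pow {1..n}"

text \<open>A labelling of a finite poset \<open>P\<close> (a subset of a partially ordered type; for
  \<open>nat set\<close> the order is inclusion) is a list enumerating it. Indices start at 0.\<close>

definition natural_labelling :: "'a::order set \<Rightarrow> 'a list \<Rightarrow> bool" where
  "natural_labelling P xs \<longleftrightarrow> distinct xs \<and> set xs = P \<and>
     (\<forall>i < length xs. \<forall>j < length xs. xs ! i < xs ! j \<longrightarrow> i < j)"

definition zeta_matrix :: "'a::order list \<Rightarrow> real mat" where
  "zeta_matrix xs =
     mat (length xs) (length xs) (\<lambda>(i, j). if xs ! i \<le> xs ! j then 1 else 0)"

text \<open>Only the values at even \<open>n \<ge> 2\<close> are meaningful; elsewhere the value is a dummy.\<close>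

fun alpha :: "nat \<Rightarrow> int" where
  "alpha n = (if n = 2 then 2
              else if even n \<and> n \<ge> 4 then 4 * alpha (n - 2) - 2
              else 0)"

declare alpha.simps [simp del]

lemma alpha_2: "alpha 2 = 2"
  by (simp add: alpha.simps)

lemma alpha_rec: "even n \<Longrightarrow> n \<ge> 4 \<Longrightarrow> alpha n = 4 * alpha (n - 2) - 2"
  by (subst alpha.simps) auto

lemma natural_labelling_exists:
  fixes P :: "'a::order set"
  assumes "finite P"
  shows "\<exists>xs. natural_labelling P xs"
  using assms
proof (induction P rule: finite_psubset_induct)
  case (psubset P)
  show ?case
  proof (cases "P = {}")
    case True
    then have "natural_labelling P []" by (simp add: natural_labelling_def)
    then show ?thesis ..
  next
    case False
    with psubset.hyps obtain m where m: "m \<in> P" "\<And>y. y \<in> P \<Longrightarrow> \<not> m < y"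
      using finite_has_maximal[of P] by (metis less_le)
    from m(1) have "P - {m} \<subset> P" by blast
    from psubset.IH[OF this] obtain xs where xs: "natural_labelling (P - {m}) xs" ..
    then have *: "distinct xs" "set xs = P - {m}"
      "\<And>i j. i < length xs \<Longrightarrow> j < length xs \<Longrightarrow> xs ! i < xs ! j \<Longrightarrow> i < j"
      by (auto simp: natural_labelling_def)
    have "natural_labelling P (xs @ [m])"
      unfolding natural_labelling_def
    proof (intro conjI allI impI)
      show "distinct (xs @ [m])" "set (xs @ [m]) = P" using * m(1) by auto
      fix i j
      assume ij: "i < length (xs @ [m])" "j < length (xs @ [m])"
        "(xs @ [m]) ! i < (xs @ [m]) ! j"
      have "(xs @ [m]) ! j \<in> P"
        using ij(2) \<open>set (xs @ [m]) = P\<close> nth_mem by blast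
      then have "i \<noteq> length xs" using ij(3) m(2) by (auto simp: nth_append)
      then have i: "i < length xs" using ij(1) by simp
      show "i < j"
      proof (cases "j < length xs")
        case True
        then show ?thesis using i ij(3) *(3) by (simp add: nth_append)
      next
        case False
        then show ?thesis using i by simp
      qed
    qed
    then show ?thesis ..
  qed
qed

end

theory Submission
  imports Defs
begin

text \<open>
  In a suitable ordering of the subsets, the matrix \<open>M\<^sub>n(b) = Z + b Z\<^sup>t\<close> of rank \<open>n\<close> is
  \<open>A\<^sup>\<otimes>\<^sup>n + b (A\<^sup>t)\<^sup>\<otimes>\<^sup>n\<close> with \<open>A\<close> the \<open>2\<times>2\<close> zeta matrix of a chain. As \<open>A\<^sup>-\<^sup>1 A\<^sup>t\<close> has the primitive
  sixth roots of unity \<open>\<omega>\<close> and \<open>1 - \<omega>\<close> as eigenvalues, triangularising one tensor factor gives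
  \<open>det M\<^sub>n\<^sub>+\<^sub>1(b) = det M\<^sub>n(\<omega> b) \<cdot> det M\<^sub>n((1 - \<omega>) b)\<close>. Two such steps relate the values \<open>p, q, r\<close> of
  \<open>det M\<^sub>n\<close> at the three cube roots of unity \<open>1, \<omega>\<^sup>2, (1 - \<omega>)\<^sup>2\<close> to those for \<open>n + 2\<close>:
  \<open>p' = p\<^sup>2qr\<close>, and cyclically. For even \<open>n\<close> this gives \<open>p = 2\<^sup>\<alpha>\<close> and \<open>qr = 2\<^sup>2\<^sup>\<alpha>\<^sup>-\<^sup>2\<close>; for odd \<open>n\<close>,
  \<open>q = 0\<close> already when \<open>n = 1\<close>.
\<close>

section \<open>Determinants under relabelling and of block matrices\<close>

definition kernel_mat :: "('a \<Rightarrow> 'a \<Rightarrow> 'b) \<Rightarrow> 'a list \<Rightarrow> 'b mat" where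
  "kernel_mat F xs = mat (length xs) (length xs) (\<lambda>(i, j). F (xs ! i) (xs ! j))"

lemma kernel_mat_carrier [simp]: "kernel_mat F xs \<in> carrier_mat (length xs) (length xs)"
  by (simp add: kernel_mat_def)

text \<open>The sign of \<open>p\<close> enters once for the rows and once for the columns, and
  squares to 1.\<close>

lemma det_permute_rows_cols:
  fixes A :: "'a::comm_ring_1 mat"
  assumes A: "A \<in> carrier_mat n n" and p: "p permutes {0..<n}"
  shows "det (mat n n (\<lambda>(i, j). A $$ (p i, p j))) = det A"
proof -
  let ?B = "mat n n (\<lambda>(i, j). A $$ (p i, j))"
  have pn: "p i < n" if "i < n" for i
    using permutes_in_image[OF p, of i] that by simp
  have "mat n n (\<lambda>(i, j). A $$ (p i, p j)) =
      transpose_mat (mat n n (\<lambda>(i, j). transpose_mat ?B $$ (p i, j)))"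
    by (rule eq_matI) (auto simp: pn)
  also have "det \<dots> = det (mat n n (\<lambda>(i, j). transpose_mat ?B $$ (p i, j)))"
    by (rule det_transpose[of _ n]) simp
  also have "\<dots> = signof p * det (transpose_mat ?B)"
    by (rule det_permute_rows[OF _ p]) simp
  also have "det (transpose_mat ?B) = det ?B"
    by (rule det_transpose[of _ n]) simp
  also have "det ?B = signof p * det A"
    by (rule det_permute_rows[OF A p])
  finally show ?thesis
    by (simp add: sign_def)
qed

lemma det_kernel_mat_mset_cong:
  fixes F :: "'a \<Rightarrow> 'a \<Rightarrow> 'b::comm_ring_1"
  assumes "mset xs = mset ys"
  shows "det (kernel_mat F xs) = det (kernel_mat F ys)"
proof -
  obtain p where p: "p permutes {..<length ys}" and xs: "permute_list p ys = xs"
    using mset_eq_permutation[OF assms] .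
  have pn: "p i < length ys" if "i < length ys" for i
    using permutes_in_image[OF p, of i] that by simp
  have "length xs = length ys"
    using xs by auto
  then have "kernel_mat F xs =
      mat (length ys) (length ys) (\<lambda>(i, j). kernel_mat F ys $$ (p i, p j))"
    by (intro eq_matI) (auto simp: kernel_mat_def pn permute_list_nth[OF p] simp flip: xs)
  then show ?thesis
    using det_permute_rows_cols[OF kernel_mat_carrier, of p ys F] p
    by (simp add: atLeast0LessThan)
qed

text \<open>The two outer factors perform the change of basis triangularising \<open>A\<^sup>-\<^sup>1 A\<^sup>t\<close>.\<close>

lemma det_block_eigen_factor:
  fixes X Y :: "'a::idom mat" and w :: 'a
  assumes X: "X \<in> carrier_mat n n" and Y: "Y \<in> carrier_mat n n" and w: "w * w = w - 1"
  shows "det (four_block_mat (X + Y) X Y (X + Y)) = det (X + w \<cdot>\<^sub>m Y) * det (X + (1 - w) \<cdot>\<^sub>m Y)"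
proof -
  let ?I = "1\<^sub>m n :: 'a mat" and ?O = "0\<^sub>m n n :: 'a mat"
  let ?M = "four_block_mat (X + Y) X Y (X + Y)"
  let ?L = "four_block_mat ?I ?O (w \<cdot>\<^sub>m ?I) ?I"
  \<comment> \<open>With A = [[1, 1], [0, 1]], \<open>?M\<close> is A tensor \<open>X\<close> plus
    A^t tensor \<open>Y\<close>. Here \<open>?U\<close> is A^-1 tensor \<open>?I\<close>, so
    \<open>?U * ?M\<close> involves only the identity and A^-1 A^t.\<close>
  let ?U = "four_block_mat ?I (- ?I) ?O ?I"
  \<comment> \<open>The column (1, -w) is the eigenvector of A^-1 A^t for \<open>w\<close>;
    \<open>?L\<close> is the inverse of \<open>?Q\<close>.\<close>
  let ?Q = "four_block_mat ?I ?O ((- w) \<cdot>\<^sub>m ?I) ?I"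
  have smult_one_mult: "(c \<cdot>\<^sub>m ?I) * Z = c \<cdot>\<^sub>m Z" "Z * (c \<cdot>\<^sub>m ?I) = c \<cdot>\<^sub>m Z"
    if "Z \<in> carrier_mat n n" for c Z
    using that by (simp_all add: mult_smult_assoc_mat[of _ n n _ n] mult_smult_distrib[of _ n n _ n])
  have UM: "?U * ?M = four_block_mat X (- Y) Y (X + Y)"
    using X Y by (subst mult_four_block_mat[of _ n n _ n _ n _ _ n _ n])
      (auto intro!: arg_cong4[of _ _ _ _ _ _ _ _ four_block_mat] eq_matI)
  have LUM: "?L * (?U * ?M) =
      four_block_mat X (- Y) (w \<cdot>\<^sub>m X + Y) (X + (1 - w) \<cdot>\<^sub>m Y)"
    unfolding UM using X Y by (subst mult_four_block_mat[of _ n n _ n _ n _ _ n _ n])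
      (auto intro!: arg_cong4[of _ _ _ _ _ _ _ _ four_block_mat] eq_matI
        simp: smult_one_mult algebra_simps)
  \<comment> \<open>Right-nested form of the relation for \<open>w\<close>; it cancels the lower
    left block.\<close>
  have w': "w * (w * z) = w * z - z" for z
    using arg_cong[OF w, of "\<lambda>x. x * z"] by (simp add: left_diff_distrib mult.assoc)
  have tri: "(?L * (?U * ?M)) * ?Q =
      four_block_mat (X + w \<cdot>\<^sub>m Y) (- Y) ?O (X + (1 - w) \<cdot>\<^sub>m Y)"
    unfolding LUM using X Y
    by (subst mult_four_block_mat[of _ n n _ n _ n _ _ n _ n])
      (auto intro!: arg_cong4[of _ _ _ _ _ _ _ _ four_block_mat] eq_matI
        simp: smult_one_mult algebra_simps w')
  have M: "?M \<in> carrier_mat (n + n) (n + n)" and U: "?U \<in> carrier_mat (n + n) (n + n)"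
    and L: "?L \<in> carrier_mat (n + n) (n + n)" and Q: "?Q \<in> carrier_mat (n + n) (n + n)"
    using X Y by simp_all
  note UM_carrier = mult_carrier_mat[OF U M]
  have "det ((?L * (?U * ?M)) * ?Q) = det ?L * (det ?U * det ?M) * det ?Q"
    by (simp only: det_mult[OF mult_carrier_mat[OF L UM_carrier] Q] det_mult[OF L UM_carrier]
        det_mult[OF U M])
  moreover have "det ?L = 1" "det ?Q = 1"
    by (simp_all add: det_four_block_mat_upper_right_zero[of _ n _ n])
  moreover have "det ?U = 1"
    by (simp add: det_four_block_mat_lower_left_zero[of _ n _ n])
  moreover have "det ((?L * (?U * ?M)) * ?Q) = det (X + w \<cdot>\<^sub>m Y) * det (X + (1 - w) \<cdot>\<^sub>m Y)"
    unfolding tri using X Y by (intro det_four_block_mat_lower_left_zero[of _ n _ n]) simp_all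
  ultimately show ?thesis
    by simp
qed

section \<open>Factorisation of the determinant over subsets\<close>

fun subset_list :: "nat \<Rightarrow> nat set list" where
  "subset_list 0 = [{}]"
| "subset_list (Suc n) = subset_list n @ map (insert (Suc n)) (subset_list n)"

lemma set_subset_list: "set (subset_list n) = Pow {1..n}"
  by (induction n) (simp_all add: atLeastAtMostSuc_conv Pow_insert)

lemma distinct_subset_list: "distinct (subset_list n)"
proof (induction n)
  case (Suc n)
  have "inj_on (insert (Suc n)) (Pow {1..n})"
    by (rule inj_onI) (metis PowD Suc_n_not_le_n atLeastAtMost_iff insert_ident subsetD)
  then show ?case
    using Suc by (auto simp: distinct_map set_subset_list)
qed simp

text \<open>The weight \<open>b\<close> is there because the recursion in \<open>n\<close> does not
  stay at b = 1.\<close>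

definition sym_kernel :: "'b::comm_ring_1 \<Rightarrow> nat set \<Rightarrow> nat set \<Rightarrow> 'b" where
  "sym_kernel b S T = of_bool (S \<subseteq> T) + b * of_bool (T \<subseteq> S)"

definition sym_det :: "nat \<Rightarrow> 'b::comm_ring_1 \<Rightarrow> 'b" where
  "sym_det n b = det (kernel_mat (sym_kernel b) (subset_list n))"

lemma sym_det_0: "sym_det 0 b = 1 + b"
  by (simp add: sym_det_def det_single kernel_mat_def sym_kernel_def)

lemma sym_det_Suc:
  fixes b w :: "'b::idom"
  assumes "w * w = w - 1"
  shows "sym_det (Suc n) b = sym_det n (w * b) * sym_det n ((1 - w) * b)"
proof -
  let ?ys = "subset_list n"
  let ?X = "kernel_mat (\<lambda>S T. of_bool (S \<subseteq> T) :: 'b) ?ys"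
  let ?Y = "kernel_mat (\<lambda>S T. b * of_bool (T \<subseteq> S)) ?ys"
  have notin: "Suc n \<notin> ?ys ! i" if "i < length ?ys" for i
    using nth_mem[OF that] by (auto simp: set_subset_list)
  \<comment> \<open>Blocks are sorted by membership of \<open>Suc n\<close>: if it lies only in the
    column set, the reverse inclusion is impossible and only \<open>?X\<close> survives; if only in
    the row set, only \<open>?Y\<close>.\<close>
  have block: "kernel_mat (sym_kernel b) (subset_list (Suc n)) =
      four_block_mat (?X + ?Y) ?X ?Y (?X + ?Y)"
    by (rule eq_matI)
      (auto simp: kernel_mat_def sym_kernel_def nth_append notin subset_insert insert_subset)
  have scale: "?X + c \<cdot>\<^sub>m ?Y = kernel_mat (sym_kernel (c * b)) ?ys" for c
    by (rule eq_matI) (auto simp: kernel_mat_def sym_kernel_def)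
  show ?thesis
    unfolding sym_det_def block
    by (subst det_block_eigen_factor[OF kernel_mat_carrier kernel_mat_carrier assms])
      (simp only: scale)
qed

section \<open>Two-step recursion at the cube roots of unity\<close>

locale sixth_root =
  fixes w :: "'b::idom"
  assumes w: "w * w = w - 1"
begin

text \<open>As w(1 - w) = 1, the two mixed terms return to \<open>b\<close>; the other two scale it
  by w^2 and (1 - w)^2 = -w.\<close>

lemma sym_det_Suc_Suc:
  "sym_det (Suc (Suc n)) b = sym_det n b ^ 2 * (sym_det n ((w - 1) * b) * sym_det n (- w * b))"
proof -
  have eqs: "w * (w * b) = (w - 1) * b" "(1 - w) * (w * b) = b" "w * ((1 - w) * b) = b"
    "(1 - w) * ((1 - w) * b) = - w * b"
    by (simp_all add: algebra_simps w flip: mult.assoc)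
  show ?thesis
    by (simp only: sym_det_Suc[OF w] eqs) (simp add: power2_eq_square ac_simps)
qed

lemma sym_det_step:
  shows "sym_det (Suc (Suc n)) 1 = sym_det n 1 ^ 2 * (sym_det n (w - 1) * sym_det n (- w))"
    and "sym_det (Suc (Suc n)) (w - 1) = sym_det n (w - 1) ^ 2 * (sym_det n (- w) * sym_det n 1)"
    and "sym_det (Suc (Suc n)) (- w) = sym_det n (- w) ^ 2 * (sym_det n 1 * sym_det n (w - 1))"
proof -
  have eqs: "(w - 1) * (w - 1) = - w" "- w * (w - 1) = 1" "(w - 1) * - w = 1" "- w * - w = w - 1"
    by (simp_all add: algebra_simps w)
  show "sym_det (Suc (Suc n)) 1 = sym_det n 1 ^ 2 * (sym_det n (w - 1) * sym_det n (- w))"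
    by (simp add: sym_det_Suc_Suc)
  show "sym_det (Suc (Suc n)) (w - 1) = sym_det n (w - 1) ^ 2 * (sym_det n (- w) * sym_det n 1)"
    unfolding sym_det_Suc_Suc eqs ..
  show "sym_det (Suc (Suc n)) (- w) = sym_det n (- w) ^ 2 * (sym_det n 1 * sym_det n (w - 1))"
    unfolding sym_det_Suc_Suc eqs by (simp add: ac_simps)
qed

text \<open>For n = 1 one factor is \<open>sym_det 0 (- 1)\<close>, which vanishes, and each double
  step keeps the old value as a factor. At b = 1 the value for n = 1 is 3, so vanishing there starts
  only at n = 3.\<close>

lemma sym_det_odd_aux: "sym_det (Suc (2 * m)) (w - 1) = 0"
proof (induction m)
  case 0
  have "w * (w - 1) = - 1"
    by (simp add: algebra_simps w)
  then show ?case
    by (simp add: sym_det_Suc[OF w] sym_det_0)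
next
  case (Suc m)
  then show ?case
    using sym_det_step(2)[of "Suc (2 * m)"] by simp
qed

lemma sym_det_odd: "sym_det (Suc (Suc (Suc (2 * m)))) (1::'b) = 0"
  by (simp only: sym_det_step(1) sym_det_odd_aux) simp

end

text \<open>Makes \<open>nat\<close> and the truncated subtractions below agree with integer
  arithmetic.\<close>

lemma alpha_ge_2: "2 \<le> alpha (2 * Suc m)"
proof (induction m)
  case (Suc m)
  have "alpha (2 * Suc (Suc m)) = 4 * alpha (2 * Suc m) - 2"
    using alpha_rec[of "2 * Suc (Suc m)"] by simp
  then show ?case
    using Suc by linarith
qed (simp add: alpha_2)

text \<open>The product is carried along to close the induction: the exponents (a, c) go to (2a + c,
  3c + 2a), which preserves c = 2a - 2 and sends a to 4a - 2.\<close>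

lemma (in sixth_root) sym_det_even:
  "sym_det (2 * Suc m) (1::'b) = 2 ^ nat (alpha (2 * Suc m)) \<and>
   sym_det (2 * Suc m) (w - 1) * sym_det (2 * Suc m) (- w) = 2 ^ (2 * nat (alpha (2 * Suc m)) - 2)"
proof (induction m)
  case 0
  \<comment> \<open>The case n = 2 is computed from n = 0, which cannot be the base itself: its
    exponent is 1, while \<open>alpha 0\<close> is the dummy 0.\<close>
  have qr: "sym_det 0 (w - 1) * sym_det 0 (- w) = 1"
    by (simp add: sym_det_0 algebra_simps w)
  have p: "sym_det 0 (1::'b) = 2"
    by (simp add: sym_det_0)
  have "sym_det (Suc (Suc 0)) (w - 1) * sym_det (Suc (Suc 0)) (- w) =
      (sym_det 0 (w - 1) * sym_det 0 (- w)) ^ 3 * sym_det 0 1 ^ 2"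
    unfolding sym_det_step by (simp add: power2_eq_square power3_eq_cube ac_simps)
  moreover have "sym_det (Suc (Suc 0)) (1::'b) = 4"
    unfolding sym_det_step(1) qr p by simp
  ultimately show ?case
    using alpha_2 by (simp add: qr p numeral_2_eq_2)
next
  case (Suc m)
  let ?n = "2 * Suc m"
  define a where "a = nat (alpha ?n)"
  have a: "alpha ?n = int a" "2 \<le> a"
    using alpha_ge_2[of m] by (simp_all add: a_def)
  have "alpha (2 * Suc (Suc m)) = 4 * int a - 2"
    using alpha_rec[of "2 * Suc (Suc m)"] a by simp
  then have a': "nat (alpha (2 * Suc (Suc m))) = 4 * a - 2"
    using a(2) by simp
  have p: "sym_det ?n (1::'b) = 2 ^ a"
    and qr: "sym_det ?n (w - 1) * sym_det ?n (- w) = 2 ^ (2 * a - 2)"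
    using Suc by (simp_all only: a_def)
  have n: "2 * Suc (Suc m) = Suc (Suc ?n)"
    by simp
  have "sym_det (Suc (Suc ?n)) (1::'b) = 2 ^ (a * 2 + (2 * a - 2))"
    unfolding sym_det_step(1) qr p by (simp add: power_add power_mult)
  also have "a * 2 + (2 * a - 2) = 4 * a - 2"
    using a(2) by simp
  finally have p': "sym_det (Suc (Suc ?n)) (1::'b) = 2 ^ (4 * a - 2)" .
  have "sym_det (Suc (Suc ?n)) (w - 1) * sym_det (Suc (Suc ?n)) (- w) =
      (sym_det ?n (w - 1) * sym_det ?n (- w)) ^ 3 * sym_det ?n 1 ^ 2"
    unfolding sym_det_step by (simp add: power2_eq_square power3_eq_cube ac_simps)
  also have "\<dots> = 2 ^ ((2 * a - 2) * 3 + a * 2)"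
    unfolding p qr by (simp only: power_add power_mult)
  also have "(2 * a - 2) * 3 + a * 2 = 2 * (4 * a - 2) - 2"
    using a(2) by simp
  finally show ?case
    using p' unfolding a'[unfolded n] n by blast
qed

section \<open>Transfer to the real zeta matrix\<close>

lemma complex_of_real_det_sym_zeta:
  assumes "natural_labelling (boolean_poset n) xs"
  shows "complex_of_real (det (zeta_matrix xs + transpose_mat (zeta_matrix xs))) = sym_det n 1"
proof -
  have "distinct xs" "set xs = Pow {1..n}"
    using assms by (auto simp: natural_labelling_def boolean_poset_def)
  then have "mset xs = mset (subset_list n)"
    using set_eq_iff_mset_eq_distinct[of xs "subset_list n"]
    by (simp add: distinct_subset_list set_subset_list)
  then have "sym_det n 1 = det (kernel_mat (sym_kernel (1::complex)) xs)"
    unfolding sym_det_def by (rule det_kernel_mat_mset_cong[OF sym])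
  also have "kernel_mat (sym_kernel (1::complex)) xs =
      map_mat complex_of_real (zeta_matrix xs + transpose_mat (zeta_matrix xs))"
    by (rule eq_matI) (auto simp: kernel_mat_def sym_kernel_def zeta_matrix_def)
  finally show ?thesis
    by (simp add: of_real_hom.hom_det)
qed

theorem mainTheorem1:
  fixes n :: nat and xs :: "nat set list"
  assumes "n \<ge> 1"
    and "natural_labelling (boolean_poset n) xs"
  defines "Z \<equiv> zeta_matrix xs + transpose_mat (zeta_matrix xs)"
  shows "(n \<ge> 3 \<and> odd n \<longrightarrow> det Z = 0) \<and>
         (even n \<longrightarrow> det Z = 2 powi (alpha n))"
proof -
  \<comment> \<open>This is e^(i pi/3). The relation for \<open>w\<close> has no real solution,
    hence the detour through complex determinants.\<close>
  interpret sixth_root "Complex (1 / 2) (sqrt 3 / 2)"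
    by standard (simp add: complex_eq_iff)
  have Z: "complex_of_real (det Z) = sym_det n 1"
    unfolding Z_def by (rule complex_of_real_det_sym_zeta[OF assms(2)])
  show ?thesis
  proof (intro conjI impI)
    assume n: "n \<ge> 3 \<and> odd n"
    then have "\<exists>m. n = Suc (Suc (Suc (2 * m)))"
      by presburger
    then obtain m where "n = Suc (Suc (Suc (2 * m)))" ..
    then show "det Z = 0"
      using Z sym_det_odd by simp
  next
    assume "even n"
    then obtain m where n: "n = 2 * Suc m"
      using assms(1) by (metis evenE mult_0_right not0_implies_Suc not_one_le_zero)
    have "complex_of_real (det Z) = complex_of_real (2 ^ nat (alpha n))"
      unfolding Z n using sym_det_even by simp
    then have "det Z = 2 ^ nat (alpha n)"
      by (simp only: of_real_eq_iff)
    then show "det Z = 2 powi (alpha n)"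
      using alpha_ge_2[of m] unfolding n by (simp add: power_int_def)
  qed
qed

end
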